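(* For every odd $n\ge 9$, there exists an $n\times n$ non-consecutive by king's move Latin square that is also anti-king. For $n=7$, a non-consecutive by king's move Latin square of order $7$ exists, but there is no Latin square of order $7$ that is both non-consecutive by king's move and anti-king.
   Context: A Latin square of order $n$ is an $n\times n$ table filled with the integers $1,\dots,n$ so that each integer appears exactly once in each row and in each column. Two cells are a king's move apart if they are distinct and are horizontally, vertically or diagonally adjacent (no wrap-around). Two integers are consecutive if they differ by exactly $1$ ($1$ and $n$ are not considered consecutive). A Latin square is non-consecutive by king's move if no two cells a king's move apart contain consecutive integers. A Latin square is anti-king if no two cells a king's move apart contain the same number. *)

theory Defs
  imports Main
begin

(* A table of order n is a function of the row and the column index; only its
   values at indices in {1..n} matter. *)

definition latin_square :: "nat \<Rightarrow> (nat \<Rightarrow> nat \<Rightarrow> nat) \<Rightarrow> bool" where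
  "latin_square n L \<longleftrightarrow>
     (\<forall>i\<in>{1..n}. \<forall>j\<in>{1..n}. L i j \<in> {1..n}) \<and>
     (\<forall>i\<in>{1..n}. \<forall>k\<in>{1..n}. \<exists>!j. j \<in> {1..n} \<and> L i j = k) \<and>
     (\<forall>j\<in>{1..n}. \<forall>k\<in>{1..n}. \<exists>!i. i \<in> {1..n} \<and> L i j = k)"

definition kings_move :: "nat \<times> nat \<Rightarrow> nat \<times> nat \<Rightarrow> bool" where
  "kings_move p q \<longleftrightarrow> p \<noteq> q \<and>
     \<bar>int (fst p) - int (fst q)\<bar> \<le> 1 \<and> \<bar>int (snd p) - int (snd q)\<bar> \<le> 1"

definition consecutive :: "nat \<Rightarrow> nat \<Rightarrow> bool" where
  "consecutive a b \<longleftrightarrow> \<bar>int a - int b\<bar> = 1"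

definition non_consecutive_king :: "nat \<Rightarrow> (nat \<Rightarrow> nat \<Rightarrow> nat) \<Rightarrow> bool" where
  "non_consecutive_king n L \<longleftrightarrow>
     (\<forall>i\<in>{1..n}. \<forall>j\<in>{1..n}. \<forall>i'\<in>{1..n}. \<forall>j'\<in>{1..n}.
        kings_move (i, j) (i', j') \<longrightarrow> \<not> consecutive (L i j) (L i' j'))"

definition anti_king :: "nat \<Rightarrow> (nat \<Rightarrow> nat \<Rightarrow> nat) \<Rightarrow> bool" where
  "anti_king n L \<longleftrightarrow>
     (\<forall>i\<in>{1..n}. \<forall>j\<in>{1..n}. \<forall>i'\<in>{1..n}. \<forall>j'\<in>{1..n}.
        kings_move (i, j) (i', j') \<longrightarrow> L i j \<noteq> L i' j')"

end

theory Submission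
  imports Defs
begin

text \<open>
  For odd \<open>n\<close>, the entries \<open>2 i + b j\<close> modulo \<open>n\<close> with \<open>b \<in> {2, 4}\<close> form a Latin square.
  A king's move changes \<open>2 i + b j\<close> by an even integer, of absolute value at most \<open>b + 2\<close>. If
  \<open>b + 3 < n\<close>, this change can be congruent to \<open>0\<close> or \<open>\<plusminus>1\<close> modulo \<open>n\<close> only if it is \<open>0\<close>,
  so consecutive integers never occur. For \<open>b = 4\<close> a change of \<open>0\<close> is impossible, and \<open>n \<ge> 9\<close>
  is allowed; for \<open>n = 7\<close> one takes \<open>b = 2\<close> and loses only the anti-king property.

  For \<open>n = 7\<close> both properties are incompatible: any two cells of a \<open>2 \<times> 2\<close> block are a king's
  move apart, so the four entries of the block have pairwise distance at least \<open>2\<close>. Hence they are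
  \<open>1, 3, 5, 7\<close>, and the number \<open>2\<close> occurs nowhere.
\<close>

text \<open>An injective self-map of a finite set is a bijection, so injectivity of all rows and
  columns already gives existence and uniqueness of every value.\<close>

lemma latin_squareI:
  assumes range: "\<And>i j. i \<in> {1..n} \<Longrightarrow> j \<in> {1..n} \<Longrightarrow> L i j \<in> {1..n}"
    and rows: "\<And>i. i \<in> {1..n} \<Longrightarrow> inj_on (L i) {1..n}"
    and cols: "\<And>j. j \<in> {1..n} \<Longrightarrow> inj_on (\<lambda>i. L i j) {1..n}"
  shows "latin_square n L"
proof -
  have ex1: "\<exists>!x. x \<in> {1..n} \<and> f x = k"
    if "inj_on f {1..n}" "f ` {1..n} \<subseteq> {1..n}" "k \<in> {1..n}" for f :: "nat \<Rightarrow> nat" and k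
  proof -
    have "k \<in> f ` {1..n}"
      using endo_inj_surj[OF _ that(2,1)] that(3) by simp
    then show ?thesis
      using inj_onD[OF that(1)] by blast
  qed
  show ?thesis
    unfolding latin_square_def
    using range rows cols by (intro conjI ballI ex1) auto
qed

definition cyclic_square :: "nat \<Rightarrow> nat \<Rightarrow> nat \<Rightarrow> nat \<Rightarrow> nat \<Rightarrow> nat" where
  "cyclic_square a b n i j = Suc ((a * i + b * j) mod n)"

text \<open>Modulo \<open>n\<close> each entry is its linear form plus 1, and the shift by 1 cancels
  in differences.\<close>

lemma cyclic_square_diff_dvd:
  "int n dvd int a * (int i - int i') + int b * (int j - int j')
     - (int (cyclic_square a b n i j) - int (cyclic_square a b n i' j'))"
proof -
  have "int n dvd (int a * int k + int b * int l) - (int (cyclic_square a b n k l) - 1)" for k l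
    by (simp add: cyclic_square_def zmod_int)
  from dvd_diff[OF this[of i j] this[of i' j']] show ?thesis
    by (simp add: algebra_simps)
qed

lemma dvd_abs_less_imp_0: "int n dvd d \<Longrightarrow> \<bar>d\<bar> < int n \<Longrightarrow> d = 0"
  using dvd_imp_le_int[of d "int n"] by fastforce

text \<open>A coefficient coprime to \<open>n\<close> cancels modulo \<open>n\<close>, and two
  indices in \<open>{1..n}\<close> that are congruent modulo \<open>n\<close> are equal.\<close>

lemma latin_square_cyclic_square:
  assumes "n > 0" "coprime a n" "coprime b n"
  shows "latin_square n (cyclic_square a b n)"
proof -
  have cancel: "x = y"
    if "int n dvd int c * (int x - int y)" "coprime c n" "x \<in> {1..n}" "y \<in> {1..n}" for c x y
  proof -
    have "int n dvd int x - int y"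
      using that(1,2) by (simp add: coprime_dvd_mult_right_iff coprime_commute)
    then show "x = y"
      using that(3,4) dvd_abs_less_imp_0[of n "int x - int y"] by auto
  qed
  show ?thesis
  proof (rule latin_squareI)
    fix i j
    show "cyclic_square a b n i j \<in> {1..n}"
      using assms(1) by (simp add: cyclic_square_def Suc_leI)
    show "inj_on (cyclic_square a b n i) {1..n}"
    proof (rule inj_onI)
      fix j j'
      assume "j \<in> {1..n}" "j' \<in> {1..n}" "cyclic_square a b n i j = cyclic_square a b n i j'"
      then show "j = j'"
        using cancel[of b j j'] assms(3) cyclic_square_diff_dvd[of n a i i b j j'] by simp
    qed
    show "inj_on (\<lambda>i. cyclic_square a b n i j) {1..n}"
    proof (rule inj_onI)
      fix i i'
      assume "i \<in> {1..n}" "i' \<in> {1..n}" "cyclic_square a b n i j = cyclic_square a b n i' j"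
      then show "i = i'"
        using cancel[of a i i'] assms(2) cyclic_square_diff_dvd[of n a i i' b j j] by simp
    qed
  qed
qed

text \<open>The two sides are congruent modulo \<open>n\<close> and differ by at most 2 +
  \<open>b\<close> + 1 < \<open>n\<close>, so the congruence is an equality of integers. The bound 1
  on the entries covers equal and consecutive entries at once.\<close>

lemma cyclic_square_king_diff:
  assumes "b + 3 < n" "kings_move (i, j) (i', j')"
    and "\<bar>int (cyclic_square 2 b n i j) - int (cyclic_square 2 b n i' j')\<bar> \<le> 1"
  shows "2 * (int i - int i') + int b * (int j - int j') =
    int (cyclic_square 2 b n i j) - int (cyclic_square 2 b n i' j')"
proof -
  have ij: "\<bar>int i - int i'\<bar> \<le> 1" "\<bar>int j - int j'\<bar> \<le> 1"
    using assms(2) by (simp_all add: kings_move_def)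
  have triangle: "\<bar>2 * x + y - e\<bar> < int n"
    if "\<bar>x\<bar> \<le> 1" "\<bar>y\<bar> \<le> int b" "\<bar>e\<bar> \<le> 1" for x y e :: int
    using that assms(1) by linarith
  have "\<bar>int b * (int j - int j')\<bar> \<le> int b"
    using mult_left_mono[OF ij(2), of "int b"] by (simp add: abs_mult)
  from triangle[OF ij(1) this assms(3)]
  have "\<bar>2 * (int i - int i') + int b * (int j - int j')
      - (int (cyclic_square 2 b n i j) - int (cyclic_square 2 b n i' j'))\<bar> < int n" .
  from dvd_abs_less_imp_0[OF _ this] show ?thesis
    using cyclic_square_diff_dvd[of n 2 i i' b j j'] by simp
qed

lemma non_consecutive_king_cyclic_square:
  assumes "even b" "b + 3 < n"
  shows "non_consecutive_king n (cyclic_square 2 b n)"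
  unfolding non_consecutive_king_def consecutive_def
proof (intro ballI impI notI)
  fix i j i' j'
  assume "kings_move (i, j) (i', j')"
    and one: "\<bar>int (cyclic_square 2 b n i j) - int (cyclic_square 2 b n i' j')\<bar> = 1"
  then have "2 * (int i - int i') + int b * (int j - int j') =
      int (cyclic_square 2 b n i j) - int (cyclic_square 2 b n i' j')"
    using cyclic_square_king_diff[OF assms(2)] by simp
  moreover have "even (2 * (int i - int i') + int b * (int j - int j'))"
    using assms(1) by simp
  ultimately show False
    using one by (metis dvd_abs_iff odd_one)
qed

lemma anti_king_cyclic_square:
  assumes "n > 7"
  shows "anti_king n (cyclic_square 2 4 n)"
  unfolding anti_king_def
proof (intro ballI impI notI)
  fix i j i' j'
  assume king: "kings_move (i, j) (i', j')"
    and "cyclic_square 2 4 n i j = cyclic_square 2 4 n i' j'"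
  then have "2 * (int i - int i') + 4 * (int j - int j') = 0"
    using cyclic_square_king_diff[of 4 n i j i' j'] assms by simp
  \<comment> \<open>Halving gives \<open>i - i' = -2 * (j - j')\<close> over the integers; as both
    differences lie between -1 and 1, both vanish, but the cells are distinct.\<close>
  then show False
    using king unfolding kings_move_def prod.inject fst_conv snd_conv by presburger
qed

lemma not_non_consecutive_and_anti_king_7:
  assumes "latin_square 7 L" "non_consecutive_king 7 L" "anti_king 7 L"
  shows False
proof -
  have far: "\<bar>int (L i j) - int (L i' j')\<bar> > 1"
    if "kings_move (i, j) (i', j')" "i \<in> {1..7}" "j \<in> {1..7}" "i' \<in> {1..7}" "j' \<in> {1..7}"
    for i j i' j'
  proof -
    have "\<bar>int (L i j) - int (L i' j')\<bar> \<noteq> 1" "L i j \<noteq> L i' j'"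
      using that assms(2,3)
      unfolding non_consecutive_king_def anti_king_def consecutive_def by blast+
    then show ?thesis
      by linarith
  qed
  have range: "L i j \<in> {1..7}" if "i \<in> {1..7}" "j \<in> {1..7}" for i j
    using assms(1) that unfolding latin_square_def by blast
  have "\<forall>k\<in>{1..7}. \<exists>!j. j \<in> {1..7} \<and> L 1 j = k"
    using assms(1) unfolding latin_square_def by simp
  then have "\<exists>!j. j \<in> {1..7} \<and> L 1 j = 2"
    by (rule bspec) simp
  then obtain j where j: "j \<in> {1..7}" "L 1 j = 2"
    by blast
  \<comment> \<open>Columns \<open>j\<close> and \<open>k\<close> in rows 1 and 2 form a block with
    the number 2 in one corner.\<close>
  obtain k where k: "k \<in> {1..7}" "\<bar>int k - int j\<bar> = 1"
  proof (cases "j = 7")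
    case True
    then show ?thesis using that[of 6] by simp
  next
    case False
    then show ?thesis using that[of "Suc j"] j by simp
  qed
  have jk: "j \<noteq> k" "\<bar>int j - int k\<bar> \<le> 1"
    using k(2) by auto
  have ge4: "4 \<le> L a b"
    if "kings_move (1, j) (a, b)" "a \<in> {1..7}" "b \<in> {1..7}" for a b
  proof -
    have "\<bar>2 - int (L a b)\<bar> > 1"
      using far[OF that(1) _ j(1) that(2,3)] j(2) by simp
    then show ?thesis
      using range[OF that(2,3)] by (auto simp: abs_if split: if_splits)
  qed
  have "4 \<le> L 2 j" "4 \<le> L 1 k" "4 \<le> L 2 k"
    using j(1) k(1) jk by (auto intro!: ge4 simp: kings_move_def)
  moreover have "L 2 j \<le> 7" "L 1 k \<le> 7" "L 2 k \<le> 7"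
    using range[of 2 j] range[of 1 k] range[of 2 k] j(1) k(1) by simp_all
  moreover have "\<bar>int (L 2 j) - int (L 1 k)\<bar> > 1" "\<bar>int (L 2 j) - int (L 2 k)\<bar> > 1"
    "\<bar>int (L 1 k) - int (L 2 k)\<bar> > 1"
    using j(1) k(1) jk by (auto intro!: far simp: kings_move_def)
  \<comment> \<open>Three numbers with pairwise distance at least 2 span at least 4, but 4 to 7 span
    only 3.\<close>
  ultimately show False
    by linarith
qed

theorem theorem3:
  shows "(\<forall>n::nat. odd n \<and> n \<ge> 9 \<longrightarrow>
            (\<exists>L. latin_square n L \<and> non_consecutive_king n L \<and> anti_king n L)) \<and>
         (\<exists>L. latin_square 7 L \<and> non_consecutive_king 7 L) \<and>
         \<not> (\<exists>L. latin_square 7 L \<and> non_consecutive_king 7 L \<and> anti_king 7 L)"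
proof (intro conjI allI impI)
  fix n :: nat
  assume n: "odd n \<and> n \<ge> 9"
  then have "coprime 2 n"
    by simp
  then have "coprime (2 ^ 2) n"
    using coprime_power_left_iff by blast
  then have "latin_square n (cyclic_square 2 4 n)"
    using n \<open>coprime 2 n\<close> by (simp add: latin_square_cyclic_square)
  moreover have "non_consecutive_king n (cyclic_square 2 4 n)"
    using n by (simp add: non_consecutive_king_cyclic_square)
  moreover have "anti_king n (cyclic_square 2 4 n)"
    using n by (simp add: anti_king_cyclic_square)
  ultimately show "\<exists>L. latin_square n L \<and> non_consecutive_king n L \<and> anti_king n L"
    by blast
next
  have "latin_square 7 (cyclic_square 2 2 7)"
    by (simp add: latin_square_cyclic_square)
  moreover have "non_consecutive_king 7 (cyclic_square 2 2 7)"
    by (simp add: non_consecutive_king_cyclic_square)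
  ultimately show "\<exists>L. latin_square 7 L \<and> non_consecutive_king 7 L"
    by blast
next
  show "\<not> (\<exists>L. latin_square 7 L \<and> non_consecutive_king 7 L \<and> anti_king 7 L)"
    using not_non_consecutive_and_anti_king_7 by blast
qed

end
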